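(* Let $X$ be either $C[0,2\pi]$ or $L^p[0,2\pi]$ for some $1\leq p\leq\infty$ (real-valued functions, Lebesgue measure), and let $\mathscr S\colon X\to X$ be the integral operator $$(\mathscr S f)(s)=\int_0^{2\pi} f(t)\,(1+\cos(s-t))\,dt$$ (where, in the case $X=L^p[0,2\pi]$, the equality holds for almost every $s\in[0,2\pi]$). Then the nonnegative rank of $\mathscr S$ is infinite.
   Context: All spaces are real and carry their usual (almost everywhere) pointwise order. A linear operator $T\colon X\to Y$ between ordered vector spaces is positive if it maps $X_+$ into $Y_+$. A positive operator $T\colon X\to Y$ between ordered vector spaces has finite nonnegative rank if there exist a finite-dimensional Archimedean vector lattice $Z$ (equivalently $Z=\mathbb R^k$, $k\ge 0$, with the coordinatewise order) and positive linear operators $R\colon X\to Z$ and $L\colon Z\to Y$ with $T=LR$. In that case the nonnegative rank $\operatorname{rank}^+(T)$ is the minimal possible $\dim Z$; otherwise $\operatorname{rank}^+(T)=\infty$. The operator $\mathscr S$ is positive since its kernel is nonnegative. *)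

theory Defs
  imports
    "HOL-Analysis.Analysis"
    "HOL-Library.Function_Algebras"
    "HOL-Library.Extended_Nat"
begin

section \<open>Positive operators and the nonnegative rank\<close>

instantiation "fun" :: (type, real_vector) real_vector
begin

definition scaleR_fun :: "real \<Rightarrow> ('a \<Rightarrow> 'b) \<Rightarrow> 'a \<Rightarrow> 'b"
  where "scaleR_fun c f = (\<lambda>x. c *\<^sub>R f x)"

instance
  by standard (simp_all add: scaleR_fun_def fun_eq_iff scaleR_add_right scaleR_add_left)

end

lemma scaleR_fun_apply [simp]: "(c *\<^sub>R f) x = c *\<^sub>R f x"
  by (simp add: scaleR_fun_def)

instance "fun" :: (type, ordered_real_vector) ordered_real_vector
  by standard (auto simp: le_fun_def intro: scaleR_left_mono scaleR_right_mono)

text \<open>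
  An ordered vector space is represented by a linear subspace \<open>X\<close> of a type of class
  \<^class>\<open>ordered_real_vector\<close>, with the inherited order, and an operator from \<open>X\<close> to \<open>Y\<close> by a
  function on the ambient types of which only the values on \<open>X\<close> are relevant.
\<close>

definition positive_operator ::
  "'a::ordered_real_vector set \<Rightarrow> 'b::ordered_real_vector set \<Rightarrow> ('a \<Rightarrow> 'b) \<Rightarrow> bool"
  where "positive_operator X Y T \<longleftrightarrow>
    (\<forall>x\<in>X. T x \<in> Y) \<and>
    (\<forall>x\<in>X. \<forall>y\<in>X. T (x + y) = T x + T y) \<and>
    (\<forall>c. \<forall>x\<in>X. T (c *\<^sub>R x) = c *\<^sub>R T x) \<and>
    (\<forall>x\<in>X. 0 \<le> x \<longrightarrow> 0 \<le> T x)"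

text \<open>
  \<open>\<real>\<^sup>k\<close> with the coordinatewise order, as the space of real sequences vanishing from index \<open>k\<close> on;
  up to isomorphism these are all finite-dimensional Archimedean vector lattices.
\<close>

definition Rn :: "nat \<Rightarrow> (nat \<Rightarrow> real) set"
  where "Rn k = {z. \<forall>i\<ge>k. z i = 0}"

definition factors_positively_through ::
  "nat \<Rightarrow> 'a::ordered_real_vector set \<Rightarrow> 'b::ordered_real_vector set \<Rightarrow> ('a \<Rightarrow> 'b) \<Rightarrow> bool"
  where "factors_positively_through k X Y T \<longleftrightarrow>
    (\<exists>R L. positive_operator X (Rn k) R \<and> positive_operator (Rn k) Y L \<and>
      (\<forall>x\<in>X. T x = L (R x)))"

text \<open>The infimum of the empty set is \<open>\<infinity>\<close> in \<^typ>\<open>enat\<close>.\<close>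

definition nonneg_rank ::
  "'a::ordered_real_vector set \<Rightarrow> 'b::ordered_real_vector set \<Rightarrow> ('a \<Rightarrow> 'b) \<Rightarrow> enat"
  where "nonneg_rank X Y T = Inf {enat k |k. factors_positively_through k X Y T}"


section \<open>The spaces\<close>

text \<open>Continuous functions on \<open>[0, 2\<pi>]\<close>, extended by \<open>0\<close> to the real line.\<close>

definition C_space :: "(real \<Rightarrow> real) set"
  where "C_space = {f. continuous_on {0..2*pi} f \<and> (\<forall>x. x \<notin> {0..2*pi} \<longrightarrow> f x = 0)}"

abbreviation leb :: "real measure"
  where "leb \<equiv> lebesgue_on {0..2*pi}"

text \<open>
  Lebesgue measurable functions on \<open>[0, 2\<pi>]\<close> modulo almost everywhere equality. The representatives
  are total functions, whose values outside \<open>[0, 2\<pi>]\<close> play no role.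
\<close>

definition ae_eq :: "(real \<Rightarrow> real) \<Rightarrow> (real \<Rightarrow> real) \<Rightarrow> bool"
  where "ae_eq f g \<longleftrightarrow> f \<in> borel_measurable leb \<and> g \<in> borel_measurable leb \<and> (AE x in leb. f x = g x)"

lemma AE_iff_cong:
  assumes "AE x in M. P x = Q x"
  shows "(AE x in M. P x) = (AE x in M. Q x)"
proof
  assume "AE x in M. P x"
  with assms show "AE x in M. Q x" by eventually_elim simp
next
  assume "AE x in M. Q x"
  with assms show "AE x in M. P x" by eventually_elim simp
qed

lemma measurable_ident_leb [measurable]: "(\<lambda>x. x) \<in> borel_measurable leb"
  by (rule continuous_imp_measurable_on_sets_lebesgue) auto

lemma part_equivp_ae_eq: "part_equivp ae_eq"
proof (rule part_equivpI)
  show "\<exists>f. ae_eq f f"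
    by (rule exI[of _ "\<lambda>_. 0"]) (simp add: ae_eq_def)
  show "symp ae_eq"
    by (rule sympI) (auto simp: ae_eq_def elim: AE_mp)
  show "transp ae_eq"
  proof (rule transpI)
    fix f g h assume fg: "ae_eq f g" and gh: "ae_eq g h"
    then have "AE x in leb. f x = g x" "AE x in leb. g x = h x"
      by (auto simp: ae_eq_def)
    then have "AE x in leb. f x = h x"
      by eventually_elim simp
    then show "ae_eq f h"
      using fg gh by (simp add: ae_eq_def)
  qed
qed

quotient_type L0 = "real \<Rightarrow> real" / partial: ae_eq
  by (rule part_equivp_ae_eq)

instantiation L0 :: ordered_real_vector
begin

lift_definition zero_L0 :: L0 is "\<lambda>_. 0"
  by (simp add: ae_eq_def)

lift_definition plus_L0 :: "L0 \<Rightarrow> L0 \<Rightarrow> L0" is "\<lambda>f g x. f x + g x"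
  by (auto simp: ae_eq_def elim!: AE_mp)

lift_definition minus_L0 :: "L0 \<Rightarrow> L0 \<Rightarrow> L0" is "\<lambda>f g x. f x - g x"
  by (auto simp: ae_eq_def elim!: AE_mp)

lift_definition uminus_L0 :: "L0 \<Rightarrow> L0" is "\<lambda>f x. - f x"
  by (auto simp: ae_eq_def)

lift_definition scaleR_L0 :: "real \<Rightarrow> L0 \<Rightarrow> L0" is "\<lambda>c f x. c * f x"
  by (auto simp: ae_eq_def elim!: AE_mp)

lift_definition less_eq_L0 :: "L0 \<Rightarrow> L0 \<Rightarrow> bool" is "\<lambda>f g. AE x in leb. f x \<le> g x"
proof -
  fix f f' g g'
  assume "ae_eq f f'" "ae_eq g g'"
  then have "AE x in leb. f x = f' x" "AE x in leb. g x = g' x"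
    by (auto simp: ae_eq_def)
  then have "AE x in leb. (f x \<le> g x) = (f' x \<le> g' x)"
    by eventually_elim simp
  then show "(AE x in leb. f x \<le> g x) = (AE x in leb. f' x \<le> g' x)"
    by (rule AE_iff_cong)
qed

definition less_L0 :: "L0 \<Rightarrow> L0 \<Rightarrow> bool"
  where "less_L0 F G \<longleftrightarrow> F \<le> G \<and> \<not> G \<le> F"

instance
proof
  fix F G H :: L0 and a b :: real
  show "F + G + H = F + (G + H)"
    by transfer (auto simp: ae_eq_def add.assoc)
  show "F + G = G + F"
    by transfer (auto simp: ae_eq_def add.commute)
  show "0 + F = F"
    by transfer (auto simp: ae_eq_def)
  show "- F + F = 0"
    by transfer (auto simp: ae_eq_def)
  show "F - G = F + - G"
    by transfer (auto simp: ae_eq_def)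
  show "a *\<^sub>R (F + G) = a *\<^sub>R F + a *\<^sub>R G"
    by transfer (auto simp: ae_eq_def algebra_simps)
  show "(a + b) *\<^sub>R F = a *\<^sub>R F + b *\<^sub>R F"
    by transfer (auto simp: ae_eq_def algebra_simps)
  show "a *\<^sub>R b *\<^sub>R F = (a * b) *\<^sub>R F"
    by transfer (auto simp: ae_eq_def algebra_simps)
  show "1 *\<^sub>R F = F"
    by transfer (auto simp: ae_eq_def)
  show "F < G \<longleftrightarrow> F \<le> G \<and> \<not> G \<le> F"
    by (rule less_L0_def)
  show "F \<le> F"
    by transfer simp
  show "F \<le> H" if "F \<le> G" "G \<le> H"
    using that by transfer (auto elim!: AE_mp)
  show "F = G" if "F \<le> G" "G \<le> F"
    using that by transfer (auto simp: ae_eq_def elim!: AE_mp)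
  show "H + F \<le> H + G" if "F \<le> G"
    using that by transfer (auto elim!: AE_mp)
  show "a *\<^sub>R F \<le> a *\<^sub>R G" if "F \<le> G" "0 \<le> a"
    using that by transfer (auto elim!: AE_mp intro!: mult_left_mono)
  show "a *\<^sub>R F \<le> b *\<^sub>R F" if "a \<le> b" "0 \<le> F"
    using that by transfer (auto elim!: AE_mp intro!: mult_right_mono)
qed

end

lift_definition mem_Lp :: "ennreal \<Rightarrow> L0 \<Rightarrow> bool" is
  "\<lambda>p f. if p = \<infinity> then \<exists>C. AE x in leb. \<bar>f x\<bar> \<le> C
         else integrable leb (\<lambda>x. \<bar>f x\<bar> powr enn2real p)"
proof -
  fix p :: ennreal and f g
  assume "ae_eq f g"
  then have [measurable]: "f \<in> borel_measurable leb" "g \<in> borel_measurable leb"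
    and eq: "AE x in leb. f x = g x"
    by (auto simp: ae_eq_def)
  have "(AE x in leb. \<bar>f x\<bar> \<le> C) = (AE x in leb. \<bar>g x\<bar> \<le> C)" for C
    using eq by (intro AE_iff_cong) (auto elim: AE_mp)
  moreover have "integrable leb (\<lambda>x. \<bar>f x\<bar> powr enn2real p)
      = integrable leb (\<lambda>x. \<bar>g x\<bar> powr enn2real p)"
    using eq by (intro integrable_cong_AE) (auto elim: AE_mp)
  ultimately show "(if p = \<infinity> then \<exists>C. AE x in leb. \<bar>f x\<bar> \<le> C
         else integrable leb (\<lambda>x. \<bar>f x\<bar> powr enn2real p)) =
      (if p = \<infinity> then \<exists>C. AE x in leb. \<bar>g x\<bar> \<le> C
         else integrable leb (\<lambda>x. \<bar>g x\<bar> powr enn2real p))"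
    by simp
qed

definition Lp_space :: "ennreal \<Rightarrow> L0 set"
  where "Lp_space p = {F. mem_Lp p F}"


section \<open>The integral operator\<close>

definition kernel_integral :: "(real \<Rightarrow> real) \<Rightarrow> real \<Rightarrow> real"
  where "kernel_integral f s = (\<integral>t. f t * (1 + cos (s - t)) \<partial>leb)"

definition S_C :: "(real \<Rightarrow> real) \<Rightarrow> real \<Rightarrow> real"
  where "S_C f = (\<lambda>s. if s \<in> {0..2*pi} then kernel_integral f s else 0)"

lemma finite_measure_leb: "finite_measure leb"
  by (rule finite_measureI) (simp add: emeasure_restrict_space)

lemma kernel_integral_measurable:
  assumes [measurable]: "f \<in> borel_measurable leb"
  shows "kernel_integral f \<in> borel_measurable leb"
proof -
  interpret finite_measure leb by (rule finite_measure_leb)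
  have "(\<lambda>s. \<integral>t. f t * (1 + cos (s - t)) \<partial>leb) \<in> borel_measurable leb"
    by measurable
  then show ?thesis
    by (simp add: kernel_integral_def[abs_def])
qed

text \<open>
  On functions that are not integrable the Bochner integral below is a junk value; the elements of
  \<open>Lp_space p\<close> with \<open>1 \<le> p\<close> are integrable.
\<close>

lift_definition S_L0 :: "L0 \<Rightarrow> L0" is kernel_integral
proof -
  fix f g assume fg: "ae_eq f g"
  then have [measurable]: "f \<in> borel_measurable leb" "g \<in> borel_measurable leb"
    and eq: "AE x in leb. f x = g x"
    by (auto simp: ae_eq_def)
  have "kernel_integral f s = kernel_integral g s" for s
    unfolding kernel_integral_def using eq by (intro integral_cong_AE) (auto elim: AE_mp)
  then show "ae_eq (kernel_integral f) (kernel_integral g)"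
    by (simp add: ae_eq_def kernel_integral_measurable)
qed


section \<open>The operator is a well-defined positive operator on each space\<close>

lemma subspace_Rn: "subspace (Rn k)"
  by (auto simp: subspace_def Rn_def)

lemma subspace_C_space: "subspace C_space"
  by (auto simp: subspace_def C_space_def plus_fun_def scaleR_fun_def zero_fun_def
      intro!: continuous_intros)

lemma integrable_kernel:
  assumes f: "integrable leb f"
  shows "integrable leb (\<lambda>t. f t * (1 + cos (s - t)))"
proof (rule Bochner_Integration.integrable_bound)
  have [measurable]: "f \<in> borel_measurable leb"
    using f by simp
  show "integrable leb (\<lambda>t. 2 * f t)"
    using f by simp
  show "(\<lambda>t. f t * (1 + cos (s - t))) \<in> borel_measurable leb"
    by measurable
  have "\<bar>1 + cos x\<bar> \<le> 2" for x :: real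
    using cos_ge_minus_one[of x] cos_le_one[of x] by linarith
  then show "AE t in leb. norm (f t * (1 + cos (s - t))) \<le> norm (2 * f t)"
    by (auto simp: abs_mult mult.commute[of "\<bar>f _\<bar>"] intro!: mult_right_mono)
qed

lemma kernel_integral_eq:
  assumes f: "integrable leb f"
  shows "kernel_integral f s = (\<integral>t. f t \<partial>leb) + cos s * (\<integral>t. f t * cos t \<partial>leb)
    + sin s * (\<integral>t. f t * sin t \<partial>leb)"
proof -
  have [measurable]: "f \<in> borel_measurable leb"
    using f by simp
  have "\<bar>u\<bar> * \<bar>v\<bar> \<le> \<bar>u\<bar>" if "\<bar>v\<bar> \<le> 1" for u v :: real
    using mult_left_mono[OF that, of "\<bar>u\<bar>"] by simp
  then have i: "integrable leb (\<lambda>t. f t * cos t)" "integrable leb (\<lambda>t. f t * sin t)"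
    by (auto intro!: Bochner_Integration.integrable_bound[OF f] simp: abs_mult)
  have "kernel_integral f s = (\<integral>t. f t + cos s * (f t * cos t) + sin s * (f t * sin t) \<partial>leb)"
    unfolding kernel_integral_def
    by (intro Bochner_Integration.integral_cong) (auto simp: cos_diff algebra_simps)
  then show ?thesis
    using f i by simp
qed

lemma kernel_integral_add:
  assumes "integrable leb f" "integrable leb g"
  shows "kernel_integral (\<lambda>x. f x + g x) s = kernel_integral f s + kernel_integral g s"
  using assms[THEN integrable_kernel] by (simp add: kernel_integral_def distrib_right)

lemma kernel_integral_scale: "kernel_integral (\<lambda>x. c * f x) s = c * kernel_integral f s"
  by (simp add: kernel_integral_def mult.assoc)

lemma one_plus_cos_nonneg: "0 \<le> 1 + cos x" for x :: real
  using cos_ge_minus_one[of x] by linarith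

lemma kernel_integral_nonneg:
  assumes "AE x in leb. 0 \<le> f x"
  shows "0 \<le> kernel_integral f s"
  unfolding kernel_integral_def using assms
  by (intro integral_nonneg_AE) (auto elim!: AE_mp simp: one_plus_cos_nonneg)

lemma continuous_kernel_integral:
  assumes "integrable leb f"
  shows "continuous_on A (kernel_integral f)"
  unfolding kernel_integral_eq[OF assms, THEN ext] by (intro continuous_intros)

lemma C_space_integrable: "f \<in> C_space \<Longrightarrow> integrable leb f"
  using absolutely_integrable_continuous_real[of 0 "2 * pi" f]
  by (simp add: C_space_def set_integrable_def integrable_restrict_space)

lemma positive_operator_S_C: "positive_operator C_space C_space S_C"
  unfolding positive_operator_def
proof (intro conjI ballI allI impI)
  fix f g :: "real \<Rightarrow> real" and c :: real assume f: "f \<in> C_space"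
  note fi = C_space_integrable[OF f]
  have "continuous_on {0..2*pi} (S_C f) \<longleftrightarrow> continuous_on {0..2*pi} (kernel_integral f)"
    by (rule continuous_on_cong) (auto simp: S_C_def)
  then show "S_C f \<in> C_space"
    using continuous_kernel_integral[OF fi] by (simp add: C_space_def) (auto simp: S_C_def)
  show "S_C (f + g) = S_C f + S_C g" if "g \<in> C_space"
    using kernel_integral_add[OF fi C_space_integrable[OF that]]
    by (auto simp: S_C_def plus_fun_def fun_eq_iff)
  show "S_C (c *\<^sub>R f) = c *\<^sub>R S_C f"
    by (auto simp: S_C_def scaleR_fun_def kernel_integral_scale fun_eq_iff)
  show "0 \<le> S_C f" if "0 \<le> f"
    using that by (auto simp: S_C_def le_fun_def intro!: kernel_integral_nonneg)
qed

lemma Lp_integrable: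
  assumes f: "f \<in> borel_measurable leb" and p: "1 \<le> p"
    and mem: "if p = \<infinity> then \<exists>C. AE x in leb. \<bar>f x\<bar> \<le> C
      else integrable leb (\<lambda>x. \<bar>f x\<bar> powr enn2real p)"
  shows "integrable leb f"
proof (cases "p = \<infinity>")
  case True
  then obtain C where "AE x in leb. \<bar>f x\<bar> \<le> C"
    using mem by auto
  then show ?thesis
    by (intro finite_measure.integrable_const_bound[OF finite_measure_leb, where B = C])
      (auto simp: f)
next
  case False
  then have "1 \<le> enn2real p"
    using p by (cases p) auto
  then have le: "\<bar>u\<bar> \<le> 1 + \<bar>u\<bar> powr enn2real p" for u :: real
    using powr_mono[of 1 "enn2real p" "\<bar>u\<bar>"] by (cases "1 \<le> \<bar>u\<bar>") (auto intro: add_increasing2)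
  have "integrable leb (\<lambda>x. 1 + \<bar>f x\<bar> powr enn2real p)"
    using mem False by (simp add: finite_measure.integrable_const[OF finite_measure_leb])
  then show ?thesis
    by (rule Bochner_Integration.integrable_bound) (use f le in auto)
qed

lemma bounded_mem_Lp:
  assumes "f \<in> borel_measurable leb" "\<And>x. \<bar>f x\<bar> \<le> C"
  shows "if p = \<infinity> then \<exists>C. AE x in leb. \<bar>f x\<bar> \<le> C
    else integrable leb (\<lambda>x. \<bar>f x\<bar> powr enn2real p)"
proof -
  have "integrable leb (\<lambda>x. \<bar>f x\<bar> powr enn2real p)"
    by (rule finite_measure.integrable_const_bound[OF finite_measure_leb,
        where B = "C powr enn2real p"]) (use assms in \<open>auto intro!: AE_I2 powr_mono2\<close>)
  then show ?thesis
    using assms by auto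
qed

lemma kernel_integral_bounded:
  assumes "integrable leb f"
  shows "\<exists>C. \<forall>s. \<bar>kernel_integral f s\<bar> \<le> C"
proof -
  let ?a = "\<integral>t. f t \<partial>leb" and ?b = "\<integral>t. f t * cos t \<partial>leb" and ?c = "\<integral>t. f t * sin t \<partial>leb"
  have "\<bar>cos s * ?b\<bar> \<le> \<bar>?b\<bar>" "\<bar>sin s * ?c\<bar> \<le> \<bar>?c\<bar>" for s
    by (simp_all add: abs_mult mult_left_le_one_le)
  then have "\<bar>kernel_integral f s\<bar> \<le> \<bar>?a\<bar> + \<bar>?b\<bar> + \<bar>?c\<bar>" for s
    unfolding kernel_integral_eq[OF assms]
    by (intro order.trans[OF abs_triangle_ineq] add_mono order.refl)
  then show ?thesis
    by blast
qed

lemma subspace_Lp_space: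
  assumes p: "1 \<le> p"
  shows "subspace (Lp_space p)"
proof (rule subspaceI)
  show "0 \<in> Lp_space p"
    unfolding Lp_space_def mem_Collect_eq by transfer auto
next
  fix F G assume "F \<in> Lp_space p" "G \<in> Lp_space p"
  then show "F + G \<in> Lp_space p"
    unfolding Lp_space_def mem_Collect_eq
  proof transfer
    fix p :: ennreal and f g
    let ?m = "\<lambda>f :: real \<Rightarrow> real. if p = \<infinity> then \<exists>C. AE x in leb. \<bar>f x\<bar> \<le> C
      else integrable leb (\<lambda>x. \<bar>f x\<bar> powr enn2real p)"
    assume "ae_eq f f" "ae_eq g g" and f: "?m f" and g: "?m g"
    then have [measurable]: "f \<in> borel_measurable leb" "g \<in> borel_measurable leb"
      by (auto simp: ae_eq_def)
    show "?m (\<lambda>x. f x + g x)"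
    proof (cases "p = \<infinity>")
      case True
      then obtain C D where "AE x in leb. \<bar>f x\<bar> \<le> C" "AE x in leb. \<bar>g x\<bar> \<le> D"
        using f g by auto
      then have "AE x in leb. \<bar>f x + g x\<bar> \<le> C + D"
        by eventually_elim linarith
      with True show ?thesis
        by auto
    next
      case False
      let ?q = "enn2real p"
      have le: "\<bar>u + v\<bar> powr ?q \<le> 2 powr ?q * (\<bar>u\<bar> powr ?q + \<bar>v\<bar> powr ?q)" for u v :: real
      proof -
        have "\<bar>u + v\<bar> powr ?q \<le> (2 * max \<bar>u\<bar> \<bar>v\<bar>) powr ?q"
          by (intro powr_mono2) auto
        also have "\<dots> = 2 powr ?q * max \<bar>u\<bar> \<bar>v\<bar> powr ?q"
          by (simp add: powr_mult)
        also have "max \<bar>u\<bar> \<bar>v\<bar> powr ?q \<le> \<bar>u\<bar> powr ?q + \<bar>v\<bar> powr ?q"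
          by (auto simp: max_def)
        finally show ?thesis
          by simp
      qed
      have "integrable leb (\<lambda>x. 2 powr ?q * (\<bar>f x\<bar> powr ?q + \<bar>g x\<bar> powr ?q))"
        using f g False by simp
      then have "integrable leb (\<lambda>x. \<bar>f x + g x\<bar> powr ?q)"
        by (rule Bochner_Integration.integrable_bound) (use le in auto)
      with False show ?thesis
        by simp
    qed
  qed
next
  fix c :: real and F assume "F \<in> Lp_space p"
  then show "c *\<^sub>R F \<in> Lp_space p"
    unfolding Lp_space_def mem_Collect_eq
  proof transfer
    fix p :: ennreal and c :: real and f
    let ?m = "\<lambda>f :: real \<Rightarrow> real. if p = \<infinity> then \<exists>C. AE x in leb. \<bar>f x\<bar> \<le> C
      else integrable leb (\<lambda>x. \<bar>f x\<bar> powr enn2real p)"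
    assume f: "?m f"
    show "?m (\<lambda>x. c * f x)"
    proof (cases "p = \<infinity>")
      case True
      then obtain C where "AE x in leb. \<bar>f x\<bar> \<le> C"
        using f by auto
      then have "AE x in leb. \<bar>c * f x\<bar> \<le> \<bar>c\<bar> * C"
        by eventually_elim (simp add: abs_mult mult_left_mono)
      with True show ?thesis
        by auto
    next
      case False
      with f show ?thesis
        by (simp add: abs_mult powr_mult)
    qed
  qed
qed

lemma positive_operator_S_L0:
  assumes p: "1 \<le> p"
  shows "positive_operator (Lp_space p) (Lp_space p) S_L0"
  unfolding positive_operator_def
proof (intro conjI ballI allI impI)
  fix F G :: L0 and c :: real assume "F \<in> Lp_space p"
  then have F: "mem_Lp p F"
    by (simp add: Lp_space_def)
  show "S_L0 F \<in> Lp_space p"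
    unfolding Lp_space_def mem_Collect_eq using F
  proof (transfer fixing: p)
    fix f
    let ?m = "\<lambda>f :: real \<Rightarrow> real. if p = \<infinity> then \<exists>C. AE x in leb. \<bar>f x\<bar> \<le> C
      else integrable leb (\<lambda>x. \<bar>f x\<bar> powr enn2real p)"
    assume "ae_eq f f" and mem: "?m f"
    then have f: "f \<in> borel_measurable leb"
      by (simp add: ae_eq_def)
    have i: "integrable leb f"
      by (rule Lp_integrable[OF f p mem])
    obtain C where "\<And>s. \<bar>kernel_integral f s\<bar> \<le> C"
      using kernel_integral_bounded[OF i] by blast
    then show "?m (kernel_integral f)"
      by (rule bounded_mem_Lp[OF kernel_integral_measurable[OF f]])
  qed
  show "S_L0 (F + G) = S_L0 F + S_L0 G" if "G \<in> Lp_space p"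
    using F that unfolding Lp_space_def mem_Collect_eq
  proof (transfer fixing: p)
    fix f g
    let ?m = "\<lambda>f :: real \<Rightarrow> real. if p = \<infinity> then \<exists>C. AE x in leb. \<bar>f x\<bar> \<le> C
      else integrable leb (\<lambda>x. \<bar>f x\<bar> powr enn2real p)"
    assume "ae_eq f f" "ae_eq g g" and mem: "?m f" "?m g"
    then have m: "f \<in> borel_measurable leb" "g \<in> borel_measurable leb"
      by (simp_all add: ae_eq_def)
    have i: "integrable leb f" "integrable leb g"
      by (rule Lp_integrable[OF m(1) p mem(1)], rule Lp_integrable[OF m(2) p mem(2)])
    show "ae_eq (kernel_integral (\<lambda>x. f x + g x)) (\<lambda>x. kernel_integral f x + kernel_integral g x)"
      using m[THEN kernel_integral_measurable]
      by (simp add: ae_eq_def kernel_integral_add[OF i, abs_def])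
  qed
  show "S_L0 (c *\<^sub>R F) = c *\<^sub>R S_L0 F"
    by transfer (auto simp: ae_eq_def kernel_integral_scale[abs_def]
        intro!: borel_measurable_times kernel_integral_measurable)
  show "0 \<le> S_L0 F" if "0 \<le> F"
    using that by transfer (simp add: kernel_integral_nonneg)
qed

end

theory Submission
  imports Defs
begin

text \<open>
  A factorization through \<open>\<real>\<^sup>k\<close> puts every \<open>\<S> f\<close> with \<open>f \<ge> 0\<close> into the cone generated by
  finitely many positive functions \<open>g\<^sub>i\<close>. Let \<open>f\<close> run through an approximate identity at
  \<open>\<theta>\<close>, so that \<open>\<S> f\<close> tends to \<open>1 + cos (s - \<theta>)\<close>, and let \<open>I \<theta>\<close> be the set of those \<open>i\<close> whose
  coefficients do not tend to \<open>0\<close>. There are only finitely many sets \<open>I \<theta>\<close>, hence \<open>I \<theta> = I \<theta>'\<close>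
  for some \<open>\<theta> \<noteq> \<theta>'\<close>. But every \<open>g\<^sub>i\<close> with \<open>i \<in> I \<theta>\<close> is bounded by a multiple of
  \<open>1 + cos (s - \<theta>)\<close>, so that \<open>1 + cos (s - \<theta>') \<le> K (1 + cos (s - \<theta>))\<close> almost everywhere, and
  by continuity everywhere, which fails at the zero \<open>s = \<theta> + \<pi>\<close> of the right-hand side.
\<close>

section \<open>Limits inside a finitely generated cone\<close>

text \<open>A generator whose \<open>z\<close>-coefficients do not tend to 0 is bounded by a
  multiple of \<open>u\<close>; by \<open>imp\<close>, every other generator also drops out of the
  limit \<open>v\<close>. What survives in \<open>v\<close> is thus controlled by
  \<open>u\<close>.\<close>

lemma cone_limit_dominated:
  fixes g :: "'i \<Rightarrow> 's \<Rightarrow> real" and z w :: "nat \<Rightarrow> 'i \<Rightarrow> real"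
  assumes N: "finite N"
    and g: "\<And>i s. i \<in> N \<Longrightarrow> s \<in> A \<Longrightarrow> 0 \<le> g i s"
    and z: "\<And>n i. i \<in> N \<Longrightarrow> 0 \<le> z n i" and w: "\<And>n i. i \<in> N \<Longrightarrow> 0 \<le> w n i"
    and u: "\<And>s. s \<in> A \<Longrightarrow> (\<lambda>n. \<Sum>i\<in>N. z n i * g i s) \<longlonglongrightarrow> u s"
    and v: "\<And>s. s \<in> A \<Longrightarrow> (\<lambda>n. \<Sum>i\<in>N. w n i * g i s) \<longlonglongrightarrow> v s"
    and imp: "\<And>i. i \<in> N \<Longrightarrow> (\<lambda>n. z n i) \<longlonglongrightarrow> 0 \<Longrightarrow> (\<lambda>n. w n i) \<longlonglongrightarrow> 0"
  obtains K where "\<And>s. s \<in> A \<Longrightarrow> v s \<le> K * u s"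
proof -
  define I where "I = {i\<in>N. \<not> (\<lambda>n. z n i) \<longlonglongrightarrow> 0}"
  have zg: "z n i * g i s \<le> (\<Sum>i\<in>N. z n i * g i s)"
    and wg: "w n i * g i s \<le> (\<Sum>i\<in>N. w n i * g i s)" if "i \<in> N" "s \<in> A" for n i s
    using that N g z w by (auto intro!: member_le_sum)
  have dom: "\<exists>C\<ge>0. \<forall>s\<in>A. g i s \<le> C * u s" if i: "i \<in> I" for i
  proof -
    have iN: "i \<in> N"
      using i by (simp add: I_def)
    \<comment> \<open>Non-convergence bounds \<open>z n i\<close> below by \<open>e\<close> only for
      infinitely many \<open>n\<close>. This suffices: for these \<open>n\<close> the sums are at
      least \<open>e * g i s\<close>, hence so is their limit \<open>u s\<close>.\<close>
    obtain e where e: "0 < e" and often: "\<exists>\<^sub>F n in sequentially. e \<le> z n i"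
      using i z[OF iN] unfolding I_def tendsto_iff
      by (auto simp: not_eventually not_less)
    have "g i s \<le> 1 / e * u s" if s: "s \<in> A" for s
    proof -
      have "e * g i s \<le> u s"
      proof (rule ccontr)
        assume "\<not> e * g i s \<le> u s"
        then have "\<forall>\<^sub>F n in sequentially. (\<Sum>i\<in>N. z n i * g i s) < e * g i s"
          using u[OF s] by (intro order_tendstoD) auto
        with often have "\<exists>\<^sub>F n in sequentially. (\<Sum>i\<in>N. z n i * g i s) < e * g i s \<and> e \<le> z n i"
          by (rule frequently_eventually_conj)
        then obtain n where "e \<le> z n i" "(\<Sum>i\<in>N. z n i * g i s) < e * g i s"
          by (auto dest: frequently_ex)
        then show False
          using zg[OF iN s, of n] mult_right_mono[of e "z n i" "g i s"] g[OF iN s] by linarith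
      qed
      with e show ?thesis
        by (simp add: field_simps)
    qed
    with e show ?thesis
      by (intro exI[of _ "1 / e"]) auto
  qed
  \<comment> \<open>One point with \<open>g i s > 0\<close> bounds \<open>w n i\<close> for all
    \<open>n\<close>, since the convergent sums at that point are bounded. If \<open>g i\<close>
    vanishes on \<open>A\<close>, the coefficients may be unbounded, but the products are 0.\<close>
  have bdd: "\<exists>K. \<forall>s\<in>A. \<forall>n. w n i * g i s \<le> K * u s" if i: "i \<in> I" for i
  proof (cases "\<forall>s\<in>A. g i s = 0")
    case True
    then show ?thesis
      by (intro exI[of _ 0]) auto
  next
    case False
    have iN: "i \<in> N"
      using i by (simp add: I_def)
    obtain s where s: "s \<in> A" and pos: "0 < g i s"
      using False g[OF iN] by (force simp: less_le)
    obtain B where B: "\<And>n. \<bar>\<Sum>i\<in>N. w n i * g i s\<bar> \<le> B"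
      using convergent_imp_Bseq[OF convergentI[OF v[OF s]]] by (auto simp: Bseq_def)
    have wB: "w n i \<le> B / g i s" for n
      using wg[OF iN s, of n] B[of n] pos by (simp add: field_simps)
    obtain C where C: "0 \<le> C" "\<And>s. s \<in> A \<Longrightarrow> g i s \<le> C * u s"
      using dom[OF i] by auto
    have "w n i * g i s' \<le> (B / g i s) * C * u s'" if "s' \<in> A" for s' n
      using mult_mono[OF wB[of n] C(2)[OF that]] g[OF iN that] order.trans[OF w[OF iN] wB[of n]]
      by (simp add: mult.assoc)
    then show ?thesis
      by blast
  qed
  then obtain K where K: "\<And>i s n. i \<in> I \<Longrightarrow> s \<in> A \<Longrightarrow> w n i * g i s \<le> K i * u s"
    by metis
  show thesis
  proof
    fix s assume s: "s \<in> A"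
    \<comment> \<open>Terms in \<open>I\<close> are replaced by their bound, which is uniform in
      \<open>n\<close>, so a limit is needed only for the terms outside \<open>I\<close>, and these
      tend to 0 by \<open>imp\<close>.\<close>
    have "(\<lambda>n. (\<Sum>i\<in>N - I. w n i * g i s) + (\<Sum>i\<in>I. K i) * u s)
        \<longlonglongrightarrow> (\<Sum>i\<in>N - I. 0 * g i s) + (\<Sum>i\<in>I. K i) * u s"
      by (intro tendsto_intros imp) (auto simp: I_def)
    moreover have "(\<Sum>i\<in>N. w n i * g i s) \<le> (\<Sum>i\<in>N - I. w n i * g i s) + (\<Sum>i\<in>I. K i) * u s" for n
    proof -
      have "(\<Sum>i\<in>N. w n i * g i s) = (\<Sum>i\<in>N - I. w n i * g i s) + (\<Sum>i\<in>I. w n i * g i s)"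
        using N by (intro sum.subset_diff) (auto simp: I_def)
      also have "(\<Sum>i\<in>I. w n i * g i s) \<le> (\<Sum>i\<in>I. K i) * u s"
        unfolding sum_distrib_right using K s by (intro sum_mono) auto
      finally show ?thesis
        by simp
    qed
    ultimately show "v s \<le> (\<Sum>i\<in>I. K i) * u s"
      using LIMSEQ_le[OF v[OF s]] by fastforce
  qed
qed

section \<open>The translates \<open>1 + cos (s - \<theta>)\<close>\<close>

text \<open>Otherwise the part of the open interval outside the closure would be a nonempty open
  null set. This lets an almost everywhere inequality between continuous functions be evaluated at a
  single point.\<close>

lemma AE_leb_imp_closure:
  assumes "AE x in leb. P x" "s \<in> {0<..<2*pi}"
  shows "s \<in> closure {x. P x}"
proof (rule ccontr)
  assume "s \<notin> closure {x. P x}"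
  define U where "U = {0<..<2*pi} - closure {x. P x}"
  have "AE x in lebesgue. x \<in> {0..2*pi} \<longrightarrow> P x"
    using assms(1) by (simp add: AE_restrict_space_iff)
  then have "{x. \<not> (x \<in> {0..2*pi} \<longrightarrow> P x)} \<in> null_sets lebesgue"
    using AE_iff_null_sets
    by (simp add: eventually_ae_filter) (metis (no_types, lifting) null_sets_completion_subset mem_Collect_eq)
  moreover have "U \<subseteq> {x. \<not> (x \<in> {0..2*pi} \<longrightarrow> P x)}"
    using closure_subset[of "{x. P x}"] by (auto simp: U_def)
  ultimately have "negligible U"
    unfolding negligible_iff_null_sets[symmetric] by (rule negligible_subset)
  moreover have "open U" "U \<noteq> {}"
    using assms(2) \<open>s \<notin> _\<close> by (auto simp: U_def)
  ultimately show False
    using open_not_negligible by blast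
qed

lemma abs_cos_diff_le: "\<bar>cos x - cos y\<bar> \<le> \<bar>x - y\<bar>" for x y :: real
proof -
  have "\<bar>sin ((x + y) / 2)\<bar> * \<bar>sin ((y - x) / 2)\<bar> \<le> 1 * \<bar>(y - x) / 2\<bar>"
    by (intro mult_mono abs_sin_le_one abs_sin_x_le_abs_x) auto
  then show ?thesis
    by (simp add: cos_diff_cos abs_mult)
qed

text \<open>Take a tent of half-width \<open>e\<close> at \<open>\<theta>\<close>, normalized to
  integral 1. As the cosine is 1-Lipschitz, averaging the kernel against it changes the value by at
  most \<open>e\<close>, uniformly in \<open>s\<close>.\<close>

lemma approximate_translate:
  assumes \<theta>: "\<theta> \<in> {0<..<2*pi}" and e: "0 < e"
  obtains h where "h \<in> C_space" "0 \<le> h"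
    "\<And>s. \<bar>kernel_integral h s - (1 + cos (s - \<theta>))\<bar> \<le> e"
proof -
  \<comment> \<open>The tent may reach beyond \<open>[0, 2\<pi>]\<close> and is cut off there, so
    its integral \<open>c\<close> depends on \<open>\<theta>\<close> and \<open>e\<close>; only
    \<open>0 < c\<close> is used.\<close>
  define f where "f x = (if x \<in> {0..2*pi} then max 0 (e - \<bar>x - \<theta>\<bar>) else 0)" for x
  have cont: "continuous_on {0..2*pi} f"
    unfolding f_def by (rule continuous_on_eq[where f = "\<lambda>x. max 0 (e - \<bar>x - \<theta>\<bar>)"])
      (auto intro!: continuous_intros)
  then have f: "f \<in> C_space"
    by (simp add: C_space_def f_def)
  note fi = C_space_integrable[OF f]
  define c where "c = (\<integral>t. f t \<partial>leb)"
  have c_eq: "c = integral {0..2*pi} f"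
    unfolding c_def using fi by (intro lebesgue_integral_eq_integral) auto
  have f0: "0 \<le> f x" for x
    by (simp add: f_def)
  have "c \<noteq> 0"
  proof
    assume "c = 0"
    then have "\<forall>x\<in>{0..2*pi}. f x = 0"
      using integral_eq_0_iff[OF cont] f0 by (simp add: c_eq)
    then have "f \<theta> = 0"
      using \<theta> by simp
    then show False
      using \<theta> e by (simp add: f_def)
  qed
  moreover have "0 \<le> c"
    unfolding c_def using f0 by simp
  ultimately have c: "0 < c"
    by simp
  show thesis
  proof
    show "(1 / c) *\<^sub>R f \<in> C_space"
      by (intro subspace_scale subspace_C_space f)
    show "0 \<le> (1 / c) *\<^sub>R f"
      using c f0 by (simp add: le_fun_def)
    fix s
    let ?d = "\<lambda>t. f t * (1 + cos (s - t)) - f t * (1 + cos (s - \<theta>))"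
    have d: "integrable leb ?d"
      using integrable_kernel[OF fi] fi by simp
    have pointwise: "\<bar>?d t\<bar> \<le> f t * e" for t
    proof (cases "\<bar>t - \<theta>\<bar> \<le> e")
      case True
      have "?d t = f t * (cos (s - t) - cos (s - \<theta>))"
        by (simp add: algebra_simps)
      moreover have "\<bar>cos (s - t) - cos (s - \<theta>)\<bar> \<le> e"
        using abs_cos_diff_le[of "s - t" "s - \<theta>"] True by linarith
      ultimately show ?thesis
        using f0[of t] by (simp add: abs_mult mult_left_mono)
    next
      case False
      then have "f t = 0"
        by (simp add: f_def)
      then show ?thesis
        by simp
    qed
    have "\<bar>\<integral>t. ?d t \<partial>leb\<bar> \<le> (\<integral>t. \<bar>?d t\<bar> \<partial>leb)"
      by (rule integral_abs_bound)
    also have "\<dots> \<le> (\<integral>t. f t * e \<partial>leb)"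
      using pointwise by (intro integral_mono integrable_abs d integrable_mult_left fi)
    also have "\<dots> = c * e"
      by (simp add: c_def)
    finally have "\<bar>\<integral>t. ?d t \<partial>leb\<bar> \<le> c * e" .
    moreover have "(\<integral>t. ?d t \<partial>leb) = kernel_integral f s - c * (1 + cos (s - \<theta>))"
      unfolding kernel_integral_def c_def using integrable_kernel[OF fi] fi by simp
    ultimately have "\<bar>kernel_integral f s - c * (1 + cos (s - \<theta>))\<bar> / c \<le> e"
      using c by (simp add: field_simps)
    moreover have "kernel_integral ((1 / c) *\<^sub>R f) s = (1 / c) * kernel_integral f s"
      using kernel_integral_scale[of "1 / c" f s] by (simp add: scaleR_fun_def)
    then have "kernel_integral ((1 / c) *\<^sub>R f) s - (1 + cos (s - \<theta>))
        = (kernel_integral f s - c * (1 + cos (s - \<theta>))) / c"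
      using c by (simp add: field_simps)
    ultimately show "\<bar>kernel_integral ((1 / c) *\<^sub>R f) s - (1 + cos (s - \<theta>))\<bar> \<le> e"
      using c by simp
  qed
qed

text \<open>At \<open>s = \<theta> + pi\<close> the right-hand side is 0 and the left-hand side is
  \<open>1 - cos (\<theta> - \<theta>')\<close>, which is positive. Angles below \<open>pi\<close>
  keep this point inside the open interval.\<close>

lemma translates_not_dominated:
  assumes \<theta>: "\<theta> \<in> {0<..<pi}" "\<theta>' \<in> {0<..<pi}" "\<theta> \<noteq> \<theta>'"
    and K: "AE s in leb. 1 + cos (s - \<theta>') \<le> K * (1 + cos (s - \<theta>))"
  shows False
proof -
  let ?S = "{s. 1 + cos (s - \<theta>') \<le> K * (1 + cos (s - \<theta>))}"
  have "closed ?S"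
    by (intro closed_Collect_le continuous_intros)
  moreover have "\<theta> + pi \<in> closure ?S"
    by (rule AE_leb_imp_closure[OF K]) (use \<theta> in auto)
  ultimately have "\<theta> + pi \<in> ?S"
    by (simp add: closure_closed)
  then have "1 \<le> cos (\<theta> - \<theta>')"
    using cos_periodic_pi[of "\<theta> - \<theta>'"] by (simp add: algebra_simps)
  then have "cos \<bar>\<theta> - \<theta>'\<bar> = cos 0"
    using cos_le_one[of "\<theta> - \<theta>'"] by simp
  then have "\<bar>\<theta> - \<theta>'\<bar> = 0"
    by (rule cos_inj_pi[rotated 4]) (use \<theta> in auto)
  with \<theta>(3) show False
    by simp
qed

section \<open>The finitely generated cone\<close>

text \<open>The common core for all spaces: the generators are functions nonnegative almost
  everywhere, and the cone condition is tested on continuous functions only.\<close>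

lemma kernel_integral_not_in_finitely_generated_cone:
  fixes g :: "nat \<Rightarrow> real \<Rightarrow> real"
  assumes g: "\<And>i. i < k \<Longrightarrow> AE s in leb. 0 \<le> g i s"
    and cone: "\<And>f. f \<in> C_space \<Longrightarrow> 0 \<le> f \<Longrightarrow>
      \<exists>c. (\<forall>i<k. 0 \<le> c i) \<and> (AE s in leb. kernel_integral f s = (\<Sum>i<k. c i * g i s))"
  shows False
proof -
  define P where "P \<theta> n h c \<longleftrightarrow> (\<forall>i<k. 0 \<le> c i) \<and>
    (AE s in leb. kernel_integral h s = (\<Sum>i<k. c i * g i s)) \<and>
    (\<forall>s. \<bar>kernel_integral h s - (1 + cos (s - \<theta>))\<bar> \<le> inverse (real (Suc n)))" for \<theta> n h c
  have "\<exists>h c. P \<theta> n h c" if "\<theta> \<in> {0<..<pi}" for \<theta> n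
  proof -
    obtain h where "h \<in> C_space" "0 \<le> h"
      "\<And>s. \<bar>kernel_integral h s - (1 + cos (s - \<theta>))\<bar> \<le> inverse (real (Suc n))"
      by (rule approximate_translate[of \<theta> "inverse (real (Suc n))"]) (use \<open>\<theta> \<in> _\<close> in auto)
    with cone[of h] show ?thesis
      unfolding P_def by blast
  qed
  then obtain h c where hc: "\<And>\<theta> n. \<theta> \<in> {0<..<pi} \<Longrightarrow> P \<theta> n (h \<theta> n) (c \<theta> n)"
    by metis
  have c: "0 \<le> c \<theta> n i" if "\<theta> \<in> {0<..<pi}" "i < k" for \<theta> n i
    using hc[OF that(1)] that(2) unfolding P_def by blast
  have h: "AE s in leb. kernel_integral (h \<theta> n) s = (\<Sum>i<k. c \<theta> n i * g i s)"
    if "\<theta> \<in> {0<..<pi}" for \<theta> n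
    using hc[OF that] unfolding P_def by blast
  have approx: "\<bar>kernel_integral (h \<theta> n) s - (1 + cos (s - \<theta>))\<bar> \<le> inverse (real (Suc n))"
    if "\<theta> \<in> {0<..<pi}" for \<theta> n s
    using hc[OF that] unfolding P_def by blast
  have lim: "(\<lambda>n. kernel_integral (h \<theta> n) s) \<longlonglongrightarrow> 1 + cos (s - \<theta>)" if "\<theta> \<in> {0<..<pi}" for \<theta> s
    by (rule LIM_zero_cancel, rule Lim_null_comparison[OF _ LIMSEQ_inverse_real_of_nat])
      (use approx[OF that] in auto)
  define I where "I \<theta> = {i\<in>{..<k}. \<not> (\<lambda>n. c \<theta> n i) \<longlonglongrightarrow> 0}" for \<theta>
  have "finite (I ` {0<..<pi})"
    by (rule finite_subset[of _ "Pow {..<k}"]) (auto simp: I_def)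
  then have "\<not> inj_on I {0<..<pi}"
    using finite_imageD infinite_Ioo[OF pi_gt_zero] by blast
  then obtain \<theta> \<theta>' where \<theta>: "\<theta> \<in> {0<..<pi}" "\<theta>' \<in> {0<..<pi}" "\<theta> \<noteq> \<theta>'" "I \<theta> = I \<theta>'"
    unfolding inj_on_def by blast
  \<comment> \<open>With the two angles fixed, only countably many almost everywhere conditions
    remain, so the set where all of them hold at once has full measure.\<close>
  define A where "A = {s. (\<forall>i<k. 0 \<le> g i s) \<and>
    (\<forall>n. kernel_integral (h \<theta> n) s = (\<Sum>i<k. c \<theta> n i * g i s)) \<and>
    (\<forall>n. kernel_integral (h \<theta>' n) s = (\<Sum>i<k. c \<theta>' n i * g i s))}"
  obtain K where "\<And>s. s \<in> A \<Longrightarrow> 1 + cos (s - \<theta>') \<le> K * (1 + cos (s - \<theta>))"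
  proof (rule cone_limit_dominated[of "{..<k}" A g "c \<theta>" "c \<theta>'"
        "\<lambda>s. 1 + cos (s - \<theta>)" "\<lambda>s. 1 + cos (s - \<theta>')"])
    show "(\<lambda>n. \<Sum>i<k. c \<theta> n i * g i s) \<longlonglongrightarrow> 1 + cos (s - \<theta>)" if "s \<in> A" for s
      using lim[OF \<theta>(1), of s] that by (simp add: A_def)
    show "(\<lambda>n. \<Sum>i<k. c \<theta>' n i * g i s) \<longlonglongrightarrow> 1 + cos (s - \<theta>')" if "s \<in> A" for s
      using lim[OF \<theta>(2), of s] that by (simp add: A_def)
    show "(\<lambda>n. c \<theta>' n i) \<longlonglongrightarrow> 0" if "i \<in> {..<k}" "(\<lambda>n. c \<theta> n i) \<longlonglongrightarrow> 0" for i
      using \<theta>(4) that by (auto simp: I_def)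
  qed (use c \<theta> in \<open>auto simp: A_def\<close>)
  moreover have "AE s in leb. s \<in> A"
    unfolding A_def mem_Collect_eq
    by (intro AE_conjI AE_all_countable[THEN iffD2] allI h \<theta>) (use g in auto)
  ultimately have "AE s in leb. 1 + cos (s - \<theta>') \<le> K * (1 + cos (s - \<theta>))"
    by (auto elim!: AE_mp)
  with \<theta>(1-3) show False
    by (rule translates_not_dominated)
qed

section \<open>Factorizations as cones\<close>

lemma positive_operator_Rn_expand:
  assumes L: "positive_operator (Rn k) Y L" and z: "z \<in> Rn k"
  shows "L z = (\<Sum>i<k. z i *\<^sub>R L (\<lambda>j. of_bool (j = i)))"
proof -
  have add: "L (x + y) = L x + L y" if "x \<in> Rn k" "y \<in> Rn k" for x y
    using L that by (simp add: positive_operator_def)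
  have scale: "L (c *\<^sub>R x) = c *\<^sub>R L x" if "x \<in> Rn k" for c x
    using L that by (simp add: positive_operator_def)
  have e: "(\<lambda>j. of_bool (j = i)) \<in> Rn k" if "i < k" for i
    using that by (auto simp: Rn_def)
  \<comment> \<open>Induction on truncations of \<open>z\<close> to its first \<open>m\<close>
    coordinates; at \<open>m = k\<close> the truncation is \<open>z\<close> itself, by the
    definition of \<open>Rn\<close>.\<close>
  have "m \<le> k \<Longrightarrow> L (\<lambda>j. if j < m then z j else 0) = (\<Sum>i<m. z i *\<^sub>R L (\<lambda>j. of_bool (j = i)))" for m
  proof (induction m)
    case 0
    show ?case
      using scale[of 0 0] by (simp add: Rn_def zero_fun_def)
  next
    case (Suc m)
    have "(\<lambda>j. if j < Suc m then z j else 0)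
        = (\<lambda>j. if j < m then z j else 0) + z m *\<^sub>R (\<lambda>j. of_bool (j = m))"
      by (auto simp: fun_eq_iff less_Suc_eq)
    moreover have "(\<lambda>j. if j < m then z j else 0) \<in> Rn k" "z m *\<^sub>R (\<lambda>j. of_bool (j = m)) \<in> Rn k"
      using Suc.prems z by (auto simp: Rn_def)
    ultimately show ?case
      using Suc by (simp add: add scale e)
  qed
  moreover have "(\<lambda>j. if j < k then z j else 0) = z"
    using z by (auto simp: Rn_def fun_eq_iff)
  ultimately show ?thesis
    by (metis order.refl)
qed

text \<open>The generators are the images of the unit vectors under \<open>L\<close>, and the
  coefficients are the coordinates of \<open>R x\<close>.\<close>

lemma factors_positively_throughE:
  assumes "factors_positively_through k X Y T"
  obtains G where "\<And>i. i < k \<Longrightarrow> 0 \<le> G i"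
    "\<And>x. x \<in> X \<Longrightarrow> 0 \<le> x \<Longrightarrow> \<exists>c. (\<forall>i<k. 0 \<le> c i) \<and> T x = (\<Sum>i<k. c i *\<^sub>R G i)"
proof -
  obtain R L where R: "positive_operator X (Rn k) R" and L: "positive_operator (Rn k) Y L"
    and T: "\<And>x. x \<in> X \<Longrightarrow> T x = L (R x)"
    using assms by (auto simp: factors_positively_through_def)
  show thesis
  proof
    show "0 \<le> L (\<lambda>j. of_bool (j = i))" if "i < k" for i
      using L that by (simp add: positive_operator_def Rn_def le_fun_def)
    fix x assume x: "x \<in> X" "0 \<le> x"
    then have "R x \<in> Rn k" "0 \<le> R x"
      using R by (auto simp: positive_operator_def)
    then show "\<exists>c. (\<forall>i<k. 0 \<le> c i) \<and> T x = (\<Sum>i<k. c i *\<^sub>R L (\<lambda>j. of_bool (j = i)))"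
      using positive_operator_Rn_expand[OF L] T[OF x(1)] by (auto simp: le_fun_def)
  qed
qed

lemma nonneg_rank_eq_infinity:
  assumes "\<And>k. \<not> factors_positively_through k X Y T"
  shows "nonneg_rank X Y T = \<infinity>"
  using assms by (simp add: nonneg_rank_def Inf_enat_def)

section \<open>Application to the function spaces\<close>

lemma S_C_not_factors: "\<not> factors_positively_through k C_space C_space S_C"
proof
  assume "factors_positively_through k C_space C_space S_C"
  then obtain G where G: "\<And>i. i < k \<Longrightarrow> 0 \<le> G i"
    and S: "\<And>f. f \<in> C_space \<Longrightarrow> 0 \<le> f \<Longrightarrow>
      \<exists>c. (\<forall>i<k. 0 \<le> c i) \<and> S_C f = (\<Sum>i<k. c i *\<^sub>R G i)"
    by (rule factors_positively_throughE) blast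
  show False
  proof (rule kernel_integral_not_in_finitely_generated_cone)
    show "AE s in leb. 0 \<le> G i s" if "i < k" for i
      using G[OF that] by (simp add: le_fun_def)
    fix f assume "f \<in> C_space" "0 \<le> f"
    then obtain c where c: "\<forall>i<k. 0 \<le> c i" "S_C f = (\<Sum>i<k. c i *\<^sub>R G i)"
      using S by blast
    have sum: "(\<Sum>i<m. c i *\<^sub>R G i) s = (\<Sum>i<m. c i * G i s)" for m s
      by (induction m) auto
    have "kernel_integral f s = (\<Sum>i<k. c i * G i s)" if "s \<in> {0..2*pi}" for s
      using fun_cong[OF c(2), of s] that by (simp add: S_C_def sum)
    then show "\<exists>c. (\<forall>i<k. 0 \<le> c i) \<and> (AE s in leb. kernel_integral f s = (\<Sum>i<k. c i * G i s))"
      using c(1) by (intro exI[of _ c]) (auto intro!: AE_I2)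
  qed
qed

lemma abs_L0_eq_iff:
  assumes "f \<in> borel_measurable leb" "g \<in> borel_measurable leb"
  shows "abs_L0 f = abs_L0 g \<longleftrightarrow> (AE x in leb. f x = g x)"
  using Quotient3_rel[OF Quotient3_L0, of f g] assms by (simp add: ae_eq_def)

lemma sum_abs_L0:
  fixes k :: nat
  assumes "\<And>i. i < k \<Longrightarrow> g i \<in> borel_measurable leb"
  shows "(\<Sum>i<k. c i *\<^sub>R abs_L0 (g i)) = abs_L0 (\<lambda>s. \<Sum>i<k. c i * g i s)"
  using assms
proof (induction k)
  case 0
  show ?case
    by (simp add: zero_L0_def)
next
  case (Suc k)
  then show ?case
    by (simp add: scaleR_L0.abs_eq plus_L0.abs_eq ae_eq_def)
qed

text \<open>A continuous function on \<open>[0, 2\<pi>]\<close> is bounded, so its class lies in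
  \<open>Lp_space p\<close>. Choosing representatives of the generators turns equality of classes
  into equality almost everywhere.\<close>

lemma S_L0_not_factors: "\<not> factors_positively_through k (Lp_space p) (Lp_space p) S_L0"
proof
  assume "factors_positively_through k (Lp_space p) (Lp_space p) S_L0"
  then obtain G where G: "\<And>i. i < k \<Longrightarrow> 0 \<le> G i"
    and S: "\<And>F. F \<in> Lp_space p \<Longrightarrow> 0 \<le> F \<Longrightarrow>
      \<exists>c. (\<forall>i<k. 0 \<le> c i) \<and> S_L0 F = (\<Sum>i<k. c i *\<^sub>R G i)"
    by (rule factors_positively_throughE) blast
  have meas: "rep_L0 F \<in> borel_measurable leb" for F
    using Quotient3_rep_reflp[OF Quotient3_L0, of F] by (simp add: ae_eq_def)
  have abs_rep: "abs_L0 (rep_L0 F) = F" for F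
    by (rule Quotient3_abs_rep[OF Quotient3_L0])
  show False
  proof (rule kernel_integral_not_in_finitely_generated_cone)
    show "AE s in leb. 0 \<le> rep_L0 (G i) s" if "i < k" for i
      using G[OF that] less_eq_L0.abs_eq[of "\<lambda>_. 0" "rep_L0 (G i)"] meas
      by (simp add: abs_rep ae_eq_def zero_L0_def)
    fix f assume f: "f \<in> C_space" "0 \<le> f"
    have m: "f \<in> borel_measurable leb"
      using C_space_integrable[OF f(1)] by simp
    have "compact (f ` {0..2*pi})"
      using f(1) by (intro compact_continuous_image) (auto simp: C_space_def)
    then obtain C where C: "\<And>x. x \<in> {0..2*pi} \<Longrightarrow> \<bar>f x\<bar> \<le> C"
      using compact_imp_bounded by (fastforce simp: bounded_iff)
    have "\<bar>f x\<bar> \<le> max 0 C" for x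
      using f(1) C[of x] by (cases "x \<in> {0..2*pi}") (auto simp: C_space_def)
    then have "abs_L0 f \<in> Lp_space p"
      unfolding Lp_space_def mem_Collect_eq
      by (subst mem_Lp.abs_eq) (use m in \<open>simp add: ae_eq_def\<close>, rule bounded_mem_Lp[OF m])
    moreover have "0 \<le> abs_L0 f"
      using f(2) m by (simp add: zero_L0_def less_eq_L0.abs_eq ae_eq_def le_fun_def)
    ultimately obtain c where c: "\<forall>i<k. 0 \<le> c i" "S_L0 (abs_L0 f) = (\<Sum>i<k. c i *\<^sub>R G i)"
      using S by blast
    have "(\<Sum>i<k. c i *\<^sub>R G i) = abs_L0 (\<lambda>s. \<Sum>i<k. c i * rep_L0 (G i) s)"
      using sum_abs_L0[of k "\<lambda>i. rep_L0 (G i)" c] meas by (simp add: abs_rep)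
    with c(2) have "abs_L0 (kernel_integral f) = abs_L0 (\<lambda>s. \<Sum>i<k. c i * rep_L0 (G i) s)"
      using m by (simp add: S_L0.abs_eq ae_eq_def)
    then have "AE s in leb. kernel_integral f s = (\<Sum>i<k. c i * rep_L0 (G i) s)"
      by (subst (asm) abs_L0_eq_iff) (auto intro!: kernel_integral_measurable borel_measurable_sum borel_measurable_times m meas)
    with c(1) show "\<exists>c. (\<forall>i<k. 0 \<le> c i) \<and>
        (AE s in leb. kernel_integral f s = (\<Sum>i<k. c i * rep_L0 (G i) s))"
      by blast
  qed
qed

theorem theorem4p4:
  shows "nonneg_rank C_space C_space S_C = \<infinity> \<and>
    (\<forall>p::ennreal. 1 \<le> p \<longrightarrow> nonneg_rank (Lp_space p) (Lp_space p) S_L0 = \<infinity>)"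
  by (simp add: nonneg_rank_eq_infinity S_C_not_factors S_L0_not_factors)

end
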